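(* Let $n\ge1$ and let $\Omega\subset\mathbb{R}^n$ be a bounded domain with Lipschitz boundary. Let $0<\delta<\delta_0$ with $1/\delta\in\mathbb{N}$ and let $N$ be a positive integer. Suppose $u:\overline{\Omega}^\delta\times([-N,N]\cap\delta\mathbb{Z})\to\mathbb{R}$ is $\delta$-discrete subharmonic, i.e. $\Delta_{\delta,n+1}u\ge0$ at every point of $\Omega^\delta\times((-N,N)\cap\delta\mathbb{Z})$, that $u(x',x_{n+1})=0$ whenever $x'\in\partial\Omega^\delta$, and that for some $A>0$ $$\sum_{x'\in\Omega^\delta}u^+(x',0)^2=A^2K^\delta>0 .$$ Then $$\max_{\Omega^\delta\times([-N,N]\cap\delta\mathbb{Z})}u(x',x_{n+1})\ \ge\ \frac A2\Big(\sum_{k=1}^{K^\delta}\exp(-a_k^\delta N)\Big)^{-1},$$ where $a_k^\delta=\delta^{-1}\cosh^{-1}\big(1+\tfrac12\delta^2\lambda_k^\delta\big)$. In particular, there exists a constant $C_\Omega>0$ that depends only on $\Omega$ (not on $\delta$, $N$, $A$ or $u$) such that, for any positive integer $N$, any such $\delta<\delta_0$, and any such $u$, $$\max_{\Omega^\delta\times([-N,N]\cap\delta\mathbb{Z})}u(x',x_{n+1})\ \ge\ C_\Omega A\exp(a_1^\delta N).$$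
   Context: Two points of $(\delta\mathbb{Z})^m$ are neighbors if they differ by $\pm\delta e_j$ for some standard basis vector $e_j$. The $\delta$-discrete Laplacian on $(\delta\mathbb{Z})^m$ is $$\Delta_{\delta,m}u(x)=\delta^{-2}\Big(\sum_{j=1}^m\big(u(x+\delta e_j)+u(x-\delta e_j)\big)-2m\,u(x)\Big).$$ $\Omega^\delta=\Omega\cap(\delta\mathbb{Z})^n$; $K^\delta$ is the number of points of $\Omega^\delta$; $\partial\Omega^\delta$ is the set of points of $(\delta\mathbb{Z})^n\setminus\Omega^\delta$ having at least one neighbor in $\Omega^\delta$; $\overline{\Omega}^\delta=\Omega^\delta\cup\partial\Omega^\delta$. The number $\delta_0>0$ is fixed, depending only on $\Omega$, so small that for $0<\delta<\delta_0$ the set $\Omega^\delta$ is a nonempty discrete domain, i.e. connected in the lattice (any two points are joined by a path of neighboring points in $\Omega^\delta$). Points of $(\delta\mathbb{Z})^{n+1}$ are written $(x',x_{n+1})$ with $x'\in(\delta\mathbb{Z})^n$, and $u^+=\max\{0,u\}$. $0<\lambda_1^\delta<\lambda_2^\delta\le\dots\le\lambda_{K^\delta}^\delta$ are the eigenvalues, counted with multiplicity, of the discrete Dirichlet problem $-\Delta_{\delta,n}f=\lambda f$ in $\Omega^\delta$, $f=0$ on $\partial\Omega^\delta$. $\cosh^{-1}$ denotes the inverse of $\cosh$ on $[0,\infty)$. *)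

theory Defs
  imports "HOL-Analysis.Analysis" "HOL-Library.Function_Algebras"
begin

definition lattice :: "real \<Rightarrow> 'a::euclidean_space set" where
  "lattice \<delta> = {x. \<forall>b\<in>Basis. \<exists>k::int. x \<bullet> b = \<delta> * of_int k}"

definition neighbours :: "real \<Rightarrow> 'a::euclidean_space \<Rightarrow> 'a \<Rightarrow> bool" where
  "neighbours \<delta> x y \<longleftrightarrow> (\<exists>b\<in>Basis. y = x + \<delta> *\<^sub>R b \<or> y = x - \<delta> *\<^sub>R b)"

(* The dimension m is that of the type 'a.  For the type (real ^ 'n) \<times> real the set Basis consists
   of the vectors (e_j, 0) and (0, 1), so there this is the Laplacian in n + 1 variables. *)
definition discrete_laplacian :: "real \<Rightarrow> ('a::euclidean_space \<Rightarrow> real) \<Rightarrow> 'a \<Rightarrow> real" where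
  "discrete_laplacian \<delta> u x =
     ((\<Sum>b\<in>Basis. u (x + \<delta> *\<^sub>R b) + u (x - \<delta> *\<^sub>R b)) - 2 * real DIM('a) * u x) / \<delta>\<^sup>2"

definition discrete_subharmonic_on ::
    "real \<Rightarrow> 'a::euclidean_space set \<Rightarrow> ('a \<Rightarrow> real) \<Rightarrow> bool" where
  "discrete_subharmonic_on \<delta> D u \<longleftrightarrow> (\<forall>z\<in>D. 0 \<le> discrete_laplacian \<delta> u z)"

definition discretization :: "'a::euclidean_space set \<Rightarrow> real \<Rightarrow> 'a set" where
  "discretization \<Omega> \<delta> = \<Omega> \<inter> lattice \<delta>"

definition discrete_boundary :: "'a::euclidean_space set \<Rightarrow> real \<Rightarrow> 'a set" where
  "discrete_boundary \<Omega> \<delta> =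
     {x \<in> lattice \<delta> - discretization \<Omega> \<delta>. \<exists>y\<in>discretization \<Omega> \<delta>. neighbours \<delta> x y}"

definition lattice_connected :: "real \<Rightarrow> 'a::euclidean_space set \<Rightarrow> bool" where
  "lattice_connected \<delta> S \<longleftrightarrow>
     (\<forall>x\<in>S. \<forall>y\<in>S. (\<lambda>v w. v \<in> S \<and> w \<in> S \<and> neighbours \<delta> v w)\<^sup>*\<^sup>* x y)"

definition mesh_threshold :: "'a::euclidean_space set \<Rightarrow> real \<Rightarrow> bool" where
  "mesh_threshold \<Omega> \<delta>\<^sub>0 \<longleftrightarrow> 0 < \<delta>\<^sub>0 \<and>
     (\<forall>\<delta>. 0 < \<delta> \<and> \<delta> < \<delta>\<^sub>0 \<longrightarrow>
        discretization \<Omega> \<delta> \<noteq> {} \<and> lattice_connected \<delta> (discretization \<Omega> \<delta>))"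

(* Near each boundary point the set is, in suitable orthonormal coordinates, the part above the graph
   of a Lipschitz function: \<nu> is the direction of the last coordinate axis, and \<phi> is a function on the
   hyperplane orthogonal to \<nu>, evaluated at the orthogonal projection of x. *)
definition lipschitz_boundary :: "'a::euclidean_space set \<Rightarrow> bool" where
  "lipschitz_boundary \<Omega> \<longleftrightarrow>
     (\<forall>p\<in>frontier \<Omega>. \<exists>r>0. \<exists>\<nu> \<phi> L. norm \<nu> = 1 \<and> L-lipschitz_on {y. y \<bullet> \<nu> = 0} \<phi> \<and>
        \<Omega> \<inter> ball p r = {x \<in> ball p r. \<phi> (x - (x \<bullet> \<nu>) *\<^sub>R \<nu>) < x \<bullet> \<nu>})"

interpretation fun_space: vector_space "\<lambda>(c::real) (f::'a \<Rightarrow> real) x. c * f x"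
  by unfold_locales (auto simp: fun_eq_iff algebra_simps)

(* Functions on the discretization and its boundary that vanish on the boundary are represented by
   their extensions by zero, so that each has exactly one representative. *)
definition dirichlet_eigenspace ::
    "'a::euclidean_space set \<Rightarrow> real \<Rightarrow> real \<Rightarrow> ('a \<Rightarrow> real) set" where
  "dirichlet_eigenspace \<Omega> \<delta> \<mu> =
     {f. (\<forall>x. x \<notin> discretization \<Omega> \<delta> \<longrightarrow> f x = 0) \<and>
         (\<forall>x\<in>discretization \<Omega> \<delta>. - discrete_laplacian \<delta> f x = \<mu> * f x)}"

definition dirichlet_spectrum :: "'a::euclidean_space set \<Rightarrow> real \<Rightarrow> real set" where
  "dirichlet_spectrum \<Omega> \<delta> = {\<mu>. \<exists>f\<in>dirichlet_eigenspace \<Omega> \<delta> \<mu>. \<exists>x. f x \<noteq> 0}"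

definition dirichlet_eigenvalue_list :: "'a::euclidean_space set \<Rightarrow> real \<Rightarrow> real list" where
  "dirichlet_eigenvalue_list \<Omega> \<delta> =
     concat (map (\<lambda>\<mu>. replicate (fun_space.dim (dirichlet_eigenspace \<Omega> \<delta> \<mu>)) \<mu>)
       (sorted_list_of_set (dirichlet_spectrum \<Omega> \<delta>)))"

(* Indexed from k = 1. *)
definition dirichlet_eigenvalue :: "'a::euclidean_space set \<Rightarrow> real \<Rightarrow> nat \<Rightarrow> real" where
  "dirichlet_eigenvalue \<Omega> \<delta> k = dirichlet_eigenvalue_list \<Omega> \<delta> ! (k - 1)"

(* arcosh x = ln (x + sqrt (x^2 - 1)) inverts cosh on [0, \<infinity>); its argument here is at least 1. *)
definition decay_rate :: "'a::euclidean_space set \<Rightarrow> real \<Rightarrow> nat \<Rightarrow> real" where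
  "decay_rate \<Omega> \<delta> k = arcosh (1 + \<delta>\<^sup>2 * dirichlet_eigenvalue \<Omega> \<delta> k / 2) / \<delta>"

definition closed_heights :: "real \<Rightarrow> nat \<Rightarrow> real set" where
  "closed_heights \<delta> N = {- real N..real N} \<inter> lattice \<delta>"

definition open_heights :: "real \<Rightarrow> nat \<Rightarrow> real set" where
  "open_heights \<delta> N = {- real N<..<real N} \<inter> lattice \<delta>"

(* Only the values of u over the discretization and its boundary, at the closed heights, enter: when
   1/\<delta> is a natural number, all neighbours of points at open heights lie at closed heights. *)
definition admissible ::
    "'a::euclidean_space set \<Rightarrow> real \<Rightarrow> nat \<Rightarrow> real \<Rightarrow> ('a \<times> real \<Rightarrow> real) \<Rightarrow> bool" where
  "admissible \<Omega> \<delta> N A u \<longleftrightarrow>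
     discrete_subharmonic_on \<delta> (discretization \<Omega> \<delta> \<times> open_heights \<delta> N) u \<and>
     (\<forall>x\<in>discrete_boundary \<Omega> \<delta>. \<forall>t\<in>closed_heights \<delta> N. u (x, t) = 0) \<and>
     (\<Sum>x\<in>discretization \<Omega> \<delta>. (max 0 (u (x, 0)))\<^sup>2) = A\<^sup>2 * real (card (discretization \<Omega> \<delta>)) \<and>
     0 < A\<^sup>2 * real (card (discretization \<Omega> \<delta>))"

end

theory Submission
  imports Defs
begin

text \<open>
  The estimate rests on one discrete energy inequality. For a lattice height $t$ let $F(t)$ be the
  Euclidean norm of $u^+(\cdot,t)$ over $\Omega^\delta$. Since $u^+$ is again subharmonic, multiplying
  $\Delta_{\delta,n+1} u^+ \ge 0$ by $u^+$, summing over $\Omega^\delta$ and applying the Rayleigh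
  inequality $\lambda_1 \sum g^2 \le \sum (-\Delta_{\delta,n} g)\, g$ together with Cauchy-Schwarz gives
  \[ F(t+\delta) + F(t-\delta) \ge (2 + \delta^2\lambda_1) F(t) = 2\cosh(a_1\delta)\, F(t) \]
  (\<open>level_norm_step\<close>). So $F$ is convex relative to the solutions of the same recursion with equality,
  and comparing the even function $F(t)+F(-t)$ with $\cosh(a_1 t)$ (\<open>cosh_comparison\<close>) yields
  $F(N)+F(-N) \ge 2\cosh(a_1 N) F(0)$. If $K$ is the number of points of $\Omega^\delta$ and $M$ the
  maximum of $u$, which is positive, then $F(0) = A\sqrt{K}$ and $F(\pm N) \le M\sqrt{K}$. Hence
  $M \ge A\cosh(a_1 N) \ge \frac{1}{2} A\exp(a_1 N)$.

  This is the second claim with the constant $1/2$. It implies the first one, because a sum of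
  exponentials is at least its first term: $\sum_k \exp(-a_k N) \ge \exp(-a_1 N)$. In particular no
  information on the higher eigenvalues is needed.

  The remaining point is that the first entry of the eigenvalue list is the infimum of the Rayleigh
  quotient (\<open>dirichlet_eigenvalue_1_rayleigh\<close>). A minimizer exists by compactness and is an
  eigenfunction by the first variation (\<open>rayleigh_minimizer\<close>); orthogonality of eigenfunctions makes
  the spectrum finite, so that its sorted list starts with the minimum.
\<close>

section \<open>Finite parts of the lattice\<close>

lemma finite_lattice_Int_bounded:
  fixes S :: "'a::euclidean_space set"
  assumes "bounded S" "0 < \<delta>"
  shows "finite (S \<inter> lattice \<delta>)"
proof -
  obtain R where R: "\<And>x. x \<in> S \<Longrightarrow> norm x \<le> R"
    using assms(1) by (auto simp: bounded_iff)
  define Z where "Z = (\<lambda>k. \<delta> * of_int k) ` {- \<lceil>R / \<delta>\<rceil> .. \<lceil>R / \<delta>\<rceil>}"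
  have "x \<in> (\<lambda>f. \<Sum>b\<in>Basis. f b *\<^sub>R b) ` (Basis \<rightarrow>\<^sub>E Z)" if x: "x \<in> S \<inter> lattice \<delta>" for x
  proof (rule image_eqI)
    show "x = (\<Sum>b\<in>Basis. restrict (\<lambda>b. x \<bullet> b) Basis b *\<^sub>R b)"
      by (simp add: euclidean_representation)
    have "x \<bullet> b \<in> Z" if b: "b \<in> Basis" for b
    proof -
      obtain k :: int where k: "x \<bullet> b = \<delta> * of_int k"
        using x b by (auto simp: lattice_def)
      have "\<bar>\<delta> * of_int k\<bar> \<le> R"
        using Basis_le_norm[OF b, of x] R[of x] x k by auto
      hence "\<bar>real_of_int k\<bar> \<le> R / \<delta>"
        using assms(2) by (simp add: field_simps abs_mult)
      hence "k \<in> {- \<lceil>R / \<delta>\<rceil> .. \<lceil>R / \<delta>\<rceil>}"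
        by (simp add: abs_le_iff) linarith
      thus ?thesis using k by (auto simp: Z_def)
    qed
    thus "restrict (\<lambda>b. x \<bullet> b) Basis \<in> Basis \<rightarrow>\<^sub>E Z" by auto
  qed
  moreover have "finite ((\<lambda>f. \<Sum>b\<in>Basis. f b *\<^sub>R b) ` ((Basis::'a set) \<rightarrow>\<^sub>E Z))"
    by (intro finite_imageI finite_PiE) (auto simp: Z_def)
  ultimately show ?thesis by (meson finite_subset subsetI)
qed

lemma lattice_neighbour:
  fixes x :: "'a::euclidean_space"
  assumes "x \<in> lattice \<delta>" "neighbours \<delta> x y"
  shows "y \<in> lattice \<delta>"
proof -
  have "\<exists>k::int. y \<bullet> c = \<delta> * of_int k" if c: "c \<in> Basis" for c
  proof -
    obtain k :: int where k: "x \<bullet> c = \<delta> * of_int k"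
      using assms(1) c by (auto simp: lattice_def)
    obtain b where b: "b \<in> Basis" "y = x + \<delta> *\<^sub>R b \<or> y = x - \<delta> *\<^sub>R b"
      using assms(2) by (auto simp: neighbours_def)
    hence "y \<bullet> c \<in> {\<delta> * of_int k, \<delta> * of_int (k + 1), \<delta> * of_int (k - 1)}"
      using c k by (cases "b = c")
        (auto simp: inner_add_left inner_diff_left inner_Basis distrib_left right_diff_distrib)
    thus ?thesis by blast
  qed
  thus ?thesis by (simp add: lattice_def)
qed

lemma neighbours_sym: "neighbours \<delta> x y \<Longrightarrow> neighbours \<delta> y x"
  unfolding neighbours_def by auto

lemma lattice_real: "lattice \<delta> = range (\<lambda>k::int. \<delta> * of_int k)"
  by (auto simp: lattice_def)

section \<open>The Dirichlet form\<close>

text \<open>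
  Adjointness of translations, which gives summation by parts. No boundary terms appear: a summand is
  zero unless both of its points lie in \<open>S\<close>.
\<close>

lemma sum_shift_swap:
  fixes f g :: "'a::ab_group_add \<Rightarrow> real"
  assumes "finite S" "\<And>x. x \<notin> S \<Longrightarrow> f x = 0" "\<And>x. x \<notin> S \<Longrightarrow> g x = 0"
  shows "(\<Sum>x\<in>S. f (x + v) * g x) = (\<Sum>x\<in>S. f x * g (x - v))"
  by (rule sum.reindex_bij_witness_not_neutral
      [of "{x\<in>S. x + v \<notin> S}" "{x\<in>S. x - v \<notin> S}" _ "\<lambda>x. x - v" "\<lambda>x. x + v"])
     (use assms in auto)

text \<open>
  The bilinear form $\langle -\Delta_\delta f, g\rangle$ over \<open>S\<close>. Throughout, functions on \<open>S\<close> with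
  zero boundary values are represented by their extensions by zero, so the Laplacian at points of
  \<open>S\<close> sees the Dirichlet condition.
\<close>

definition dirichlet_form ::
    "real \<Rightarrow> 'a::euclidean_space set \<Rightarrow> ('a \<Rightarrow> real) \<Rightarrow> ('a \<Rightarrow> real) \<Rightarrow> real" where
  "dirichlet_form \<delta> S f g = (\<Sum>x\<in>S. - discrete_laplacian \<delta> f x * g x)"

lemma neg_discrete_laplacian:
  fixes f :: "'a::euclidean_space \<Rightarrow> real"
  shows "- discrete_laplacian \<delta> f x =
    (\<Sum>b\<in>Basis. 2 * f x - f (x + \<delta> *\<^sub>R b) - f (x - \<delta> *\<^sub>R b)) / \<delta>\<^sup>2"
  unfolding discrete_laplacian_def
  by (simp add: sum_subtractf sum.distrib algebra_simps diff_divide_distrib add_divide_distrib)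

lemma discrete_laplacian_linear:
  fixes f :: "'a::euclidean_space \<Rightarrow> real"
  shows "discrete_laplacian \<delta> (\<lambda>x. a * f x + b * g x) x =
    a * discrete_laplacian \<delta> f x + b * discrete_laplacian \<delta> g x"
  unfolding discrete_laplacian_def
  by (simp add: sum.distrib sum_distrib_left algebra_simps add_divide_distrib diff_divide_distrib)

lemma dirichlet_form_eq:
  fixes f :: "'a::euclidean_space \<Rightarrow> real"
  shows "dirichlet_form \<delta> S f g = (\<Sum>b\<in>Basis. 2 * (\<Sum>x\<in>S. f x * g x)
     - (\<Sum>x\<in>S. f (x + \<delta> *\<^sub>R b) * g x) - (\<Sum>x\<in>S. f (x - \<delta> *\<^sub>R b) * g x)) / \<delta>\<^sup>2"
proof -
  have "dirichlet_form \<delta> S f g =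
      (\<Sum>x\<in>S. \<Sum>b\<in>Basis. 2 * (f x * g x) - f (x + \<delta> *\<^sub>R b) * g x - f (x - \<delta> *\<^sub>R b) * g x) / \<delta>\<^sup>2"
    unfolding dirichlet_form_def neg_discrete_laplacian sum_divide_distrib
    by (intro sum.cong refl)
       (simp add: sum_divide_distrib[symmetric] sum_distrib_left sum_distrib_right algebra_simps)
  also have "(\<Sum>x\<in>S. \<Sum>b\<in>Basis. 2 * (f x * g x) - f (x + \<delta> *\<^sub>R b) * g x - f (x - \<delta> *\<^sub>R b) * g x) =
      (\<Sum>b\<in>Basis. \<Sum>x\<in>S. 2 * (f x * g x) - f (x + \<delta> *\<^sub>R b) * g x - f (x - \<delta> *\<^sub>R b) * g x)"
    by (rule sum.swap)
  finally show ?thesis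
    by (simp only: sum_subtractf sum_distrib_left[symmetric])
qed

lemma dirichlet_form_sym:
  fixes f :: "'a::euclidean_space \<Rightarrow> real"
  assumes "finite S" "\<And>x. x \<notin> S \<Longrightarrow> f x = 0" "\<And>x. x \<notin> S \<Longrightarrow> g x = 0"
  shows "dirichlet_form \<delta> S f g = dirichlet_form \<delta> S g f"
proof -
  have plus: "(\<Sum>x\<in>S. f (x + v) * g x) = (\<Sum>x\<in>S. g (x - v) * f x)" for v
    using sum_shift_swap[of S f g v] assms by (simp add: mult.commute)
  have minus: "(\<Sum>x\<in>S. f (x - v) * g x) = (\<Sum>x\<in>S. g (x + v) * f x)" for v
    using sum_shift_swap[of S g f v] assms by (simp add: mult.commute)
  have "(\<Sum>x\<in>S. f x * g x) = (\<Sum>x\<in>S. g x * f x)"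
    by (simp add: mult.commute)
  thus ?thesis
    unfolding dirichlet_form_eq plus minus
    by (intro arg_cong2[where f = "(/)"] sum.cong refl) linarith
qed

lemma dirichlet_form_nonneg:
  fixes f :: "'a::euclidean_space \<Rightarrow> real"
  assumes "finite S" "\<And>x. x \<notin> S \<Longrightarrow> f x = 0"
  shows "0 \<le> dirichlet_form \<delta> S f f"
proof -
  have "(\<Sum>x\<in>S. f (x + v) * f x) \<le> (\<Sum>x\<in>S. f x * f x)" for v
  proof -
    have *: "(\<Sum>x\<in>S. (f (x + v))\<^sup>2) \<le> (\<Sum>x\<in>S. (f x)\<^sup>2)"
    proof -
      have "(\<Sum>x\<in>S. (f (x + v))\<^sup>2) = (\<Sum>y\<in>(\<lambda>x. x + v) ` S. (f y)\<^sup>2)"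
        by (simp add: sum.reindex)
      also have "\<dots> = (\<Sum>y\<in>(\<lambda>x. x + v) ` S \<inter> S. (f y)\<^sup>2)"
        using assms by (intro sum.mono_neutral_right) auto
      also have "\<dots> \<le> (\<Sum>x\<in>S. (f x)\<^sup>2)"
        using assms by (intro sum_mono2) auto
      finally show ?thesis .
    qed
    have "2 * (\<Sum>x\<in>S. f (x + v) * f x) \<le> (\<Sum>x\<in>S. (f (x + v))\<^sup>2 + (f x)\<^sup>2)"
      unfolding sum_distrib_left
      by (intro sum_mono) (use sum_squares_bound in \<open>metis mult.assoc\<close>)
    with * show ?thesis by (simp add: sum.distrib power2_eq_square)
  qed
  note le = this
  have "0 \<le> 2 * (\<Sum>x\<in>S. f x * f x) - (\<Sum>x\<in>S. f (x + v) * f x) - (\<Sum>x\<in>S. f (x - v) * f x)" for v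
    using le[of v] le[of "-v"] by simp
  thus ?thesis unfolding dirichlet_form_eq by (intro divide_nonneg_nonneg sum_nonneg) auto
qed

lemma dirichlet_form_add_scaled:
  fixes f :: "'a::euclidean_space \<Rightarrow> real"
  assumes "finite S" "\<And>x. x \<notin> S \<Longrightarrow> f x = 0" "\<And>x. x \<notin> S \<Longrightarrow> g x = 0"
  shows "dirichlet_form \<delta> S (\<lambda>x. f x + s * g x) (\<lambda>x. f x + s * g x) =
    dirichlet_form \<delta> S f f + 2 * s * dirichlet_form \<delta> S f g + s\<^sup>2 * dirichlet_form \<delta> S g g"
proof -
  have "dirichlet_form \<delta> S (\<lambda>x. f x + s * g x) (\<lambda>x. f x + s * g x) =
     dirichlet_form \<delta> S f f + s * dirichlet_form \<delta> S f g + s * dirichlet_form \<delta> S g f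
     + s\<^sup>2 * dirichlet_form \<delta> S g g"
    using discrete_laplacian_linear[where a = 1 and b = s and f = f and g = g]
    by (simp add: dirichlet_form_def sum_distrib_left sum.distrib[symmetric] sum_subtractf[symmetric]
        algebra_simps power2_eq_square sum_negf[symmetric])
  thus ?thesis using dirichlet_form_sym[OF assms, where \<delta> = \<delta>] by (simp add: algebra_simps)
qed

lemma dirichlet_form_scaled:
  fixes f :: "'a::euclidean_space \<Rightarrow> real"
  shows "dirichlet_form \<delta> S (\<lambda>x. s * f x) (\<lambda>x. s * f x) = s\<^sup>2 * dirichlet_form \<delta> S f f"
  using discrete_laplacian_linear[where a = s and b = 0 and f = f and g = f]
  by (simp add: dirichlet_form_def sum_distrib_left power2_eq_square algebra_simps)

text \<open>Compactness is in the product topology, in which evaluation at a point is continuous.\<close>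

lemma compact_supported_unit_sphere:
  assumes "finite S"
  shows "compact {f :: 'a \<Rightarrow> real. (\<forall>x. x \<notin> S \<longrightarrow> f x = 0) \<and> (\<Sum>x\<in>S. (f x)\<^sup>2) = 1}" (is "compact ?K")
proof -
  let ?X = "\<lambda>x. if x \<in> S then {-1..1} else {0::real}"
  have "compactin (product_topology (\<lambda>_::'a. euclidean :: real topology) UNIV) (PiE UNIV ?X)"
    by (subst compactin_PiE) auto
  hence "compact (PiE UNIV ?X)"
    by (simp add: euclidean_product_topology)
  moreover have "closed {f :: 'a \<Rightarrow> real. (\<Sum>x\<in>S. (f x)\<^sup>2) = 1}"
    by (intro closed_Collect_eq continuous_intros continuous_on_product_coordinates)
  moreover have "?K = PiE UNIV ?X \<inter> {f. (\<Sum>x\<in>S. (f x)\<^sup>2) = 1}"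
  proof -
    have "f x \<in> {-1..1}" if "(\<Sum>x\<in>S. (f x)\<^sup>2) = 1" "x \<in> S" for f :: "'a \<Rightarrow> real" and x
    proof -
      have "(f x)\<^sup>2 \<le> 1"
        using member_le_sum[OF that(2), of "\<lambda>x. (f x)\<^sup>2"] that(1) assms by simp
      thus ?thesis by (simp add: abs_square_le_1 abs_le_iff)
    qed
    moreover have "f \<in> PiE UNIV ?X \<longleftrightarrow> (\<forall>x\<in>S. f x \<in> {-1..1}) \<and> (\<forall>x. x \<notin> S \<longrightarrow> f x = 0)" for f
      by (auto simp: PiE_UNIV_domain Pi_def)
    ultimately show ?thesis by (intro set_eqI) (simp, blast)
  qed
  ultimately show ?thesis by (simp only: compact_Int_closed)
qed

text \<open>
  The last conjunct says that \<open>\<rho>\<close> bounds the Rayleigh quotient from below; it is attained at \<open>f\<close>.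
\<close>

lemma rayleigh_minimizer:
  fixes S :: "'a::euclidean_space set"
  assumes "finite S" "S \<noteq> {}"
  shows "\<exists>f \<rho>. (\<forall>x. x \<notin> S \<longrightarrow> f x = 0) \<and> (\<Sum>x\<in>S. (f x)\<^sup>2) = 1 \<and>
    (\<forall>x\<in>S. - discrete_laplacian \<delta> f x = \<rho> * f x) \<and>
    (\<forall>g. (\<forall>x. x \<notin> S \<longrightarrow> g x = 0) \<longrightarrow> \<rho> * (\<Sum>x\<in>S. (g x)\<^sup>2) \<le> dirichlet_form \<delta> S g g)"
proof -
  let ?K = "{f :: 'a \<Rightarrow> real. (\<forall>x. x \<notin> S \<longrightarrow> f x = 0) \<and> (\<Sum>x\<in>S. (f x)\<^sup>2) = 1}"
  let ?Q = "\<lambda>f :: 'a \<Rightarrow> real. dirichlet_form \<delta> S f f"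
  have cont: "continuous_on ?K ?Q"
    unfolding dirichlet_form_eq divide_inverse
    by (intro continuous_intros continuous_on_subset[OF continuous_on_product_coordinates]) auto
  obtain p where p: "p \<in> S" using assms by auto
  have "(\<Sum>x\<in>S. (if x = p then 1 else 0 :: real)\<^sup>2) = (\<Sum>x\<in>S. if x = p then 1 else 0)"
    by (intro sum.cong) auto
  hence "(\<lambda>x. if x = p then 1 else 0) \<in> ?K"
    using p assms by auto
  hence "?K \<noteq> {}" by (metis empty_iff)
  from continuous_attains_inf[OF compact_supported_unit_sphere[OF assms(1)] this cont]
  obtain f where f: "f \<in> ?K" and min: "\<And>g. g \<in> ?K \<Longrightarrow> ?Q f \<le> ?Q g"
    by (elim bexE) simp
  define \<rho> where "\<rho> = dirichlet_form \<delta> S f f"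
  have ray: "\<rho> * (\<Sum>x\<in>S. (g x)\<^sup>2) \<le> dirichlet_form \<delta> S g g" if g: "\<And>x. x \<notin> S \<Longrightarrow> g x = 0" for g
  proof (cases "(\<Sum>x\<in>S. (g x)\<^sup>2) = 0")
    case True
    thus ?thesis using dirichlet_form_nonneg[OF assms(1) g] by simp
  next
    case False
    define N where "N = (\<Sum>x\<in>S. (g x)\<^sup>2)"
    have N: "0 < N" using False sum_nonneg[of S "\<lambda>x. (g x)\<^sup>2"] by (simp add: N_def less_le)
    have "(\<lambda>x. inverse (sqrt N) * g x) \<in> ?K"
      using g N by (simp add: power_mult_distrib sum_distrib_left[symmetric] N_def[symmetric] power_inverse)
    from min[OF this] have "\<rho> \<le> inverse N * dirichlet_form \<delta> S g g"
      using N unfolding dirichlet_form_scaled \<rho>_def by (simp add: power_inverse)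
    thus ?thesis using N by (simp add: N_def[symmetric] field_simps)
  qed
  have crit: "dirichlet_form \<delta> S f g = \<rho> * (\<Sum>x\<in>S. f x * g x)"
    if g: "\<And>x. x \<notin> S \<Longrightarrow> g x = 0" for g
  proof -
    \<comment> \<open>The quadratic form minus \<open>\<rho>\<close> times the squared norm is nonnegative and vanishes at \<open>f\<close>,
      so its expansion along \<open>f + s g\<close> has no linear term.\<close>
    define b where "b = dirichlet_form \<delta> S f g - \<rho> * (\<Sum>x\<in>S. f x * g x)"
    define c where "c = dirichlet_form \<delta> S g g - \<rho> * (\<Sum>x\<in>S. (g x)\<^sup>2)"
    have c: "0 \<le> c" using ray[OF g] by (simp add: c_def)
    have quad: "0 \<le> 2 * s * b + s\<^sup>2 * c" for s
    proof -
      have "(\<Sum>x\<in>S. (f x + s * g x)\<^sup>2) =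
          (\<Sum>x\<in>S. (f x)\<^sup>2) + 2 * s * (\<Sum>x\<in>S. f x * g x) + s\<^sup>2 * (\<Sum>x\<in>S. (g x)\<^sup>2)"
        by (simp add: sum_distrib_left sum.distrib[symmetric] power2_eq_square algebra_simps)
      moreover have "\<rho> * (\<Sum>x\<in>S. (f x + s * g x)\<^sup>2) \<le>
          dirichlet_form \<delta> S (\<lambda>x. f x + s * g x) (\<lambda>x. f x + s * g x)"
        using f g by (intro ray) auto
      moreover have "dirichlet_form \<delta> S (\<lambda>x. f x + s * g x) (\<lambda>x. f x + s * g x) =
          \<rho> + 2 * s * dirichlet_form \<delta> S f g + s\<^sup>2 * dirichlet_form \<delta> S g g"
        using f g assms unfolding \<rho>_def by (intro dirichlet_form_add_scaled) auto
      ultimately show ?thesis using f by (simp add: b_def c_def algebra_simps)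
    qed
    have "b = 0"
    proof (rule ccontr)
      assume b: "b \<noteq> 0"
      \<comment> \<open>The denominator is \<open>c + 1\<close> rather than \<open>c\<close> because \<open>c\<close> may vanish.\<close>
      define s where "s = - b / (c + 1)"
      have s: "b = - s * (c + 1)" using c by (simp add: s_def)
      have "2 * s * b + s\<^sup>2 * c = - (s\<^sup>2 * (c + 2))"
        by (subst s) (simp add: algebra_simps power2_eq_square)
      also have "\<dots> < 0" using b c s by auto
      finally show False using quad[of s] by simp
    qed
    thus ?thesis by (simp add: b_def)
  qed
  have "- discrete_laplacian \<delta> f p = \<rho> * f p" if p: "p \<in> S" for p
  proof -
    have delta: "(\<Sum>x\<in>S. h x * (if x = p then 1 else 0)) = h p" for h :: "'a \<Rightarrow> real"
    proof -
      have "(\<Sum>x\<in>S. h x * (if x = p then 1 else 0)) = (\<Sum>x\<in>S. if x = p then h x else 0)"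
        by (intro sum.cong) auto
      thus ?thesis using p assms(1) by simp
    qed
    have "(if x = p then 1 else 0 :: real) = 0" if "x \<notin> S" for x
      using p that by auto
    from crit[of "\<lambda>x. if x = p then 1 else 0", OF this] show ?thesis
      unfolding dirichlet_form_def delta .
  qed
  with f ray show ?thesis by (intro exI[of _ f] exI[of _ \<rho>]) simp
qed

section \<open>The lowest Dirichlet eigenvalue\<close>

lemma dirichlet_eigenspace_supported:
  "f \<in> dirichlet_eigenspace \<Omega> \<delta> \<mu> \<Longrightarrow> x \<notin> discretization \<Omega> \<delta> \<Longrightarrow> f x = 0"
  by (simp add: dirichlet_eigenspace_def)

lemma dirichlet_form_eigenfunction:
  assumes "f \<in> dirichlet_eigenspace \<Omega> \<delta> \<mu>"
  shows "dirichlet_form \<delta> (discretization \<Omega> \<delta>) f g = \<mu> * (\<Sum>x\<in>discretization \<Omega> \<delta>. f x * g x)"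
proof -
  have "dirichlet_form \<delta> (discretization \<Omega> \<delta>) f g = (\<Sum>x\<in>discretization \<Omega> \<delta>. \<mu> * f x * g x)"
    unfolding dirichlet_form_def
    using assms by (intro sum.cong refl) (simp add: dirichlet_eigenspace_def)
  thus ?thesis by (simp add: sum_distrib_left mult.assoc)
qed

lemma dirichlet_eigenspace_orthogonal:
  assumes "finite (discretization \<Omega> \<delta>)"
    and "f \<in> dirichlet_eigenspace \<Omega> \<delta> \<mu>" "g \<in> dirichlet_eigenspace \<Omega> \<delta> \<nu>" "\<mu> \<noteq> \<nu>"
  shows "(\<Sum>x\<in>discretization \<Omega> \<delta>. f x * g x) = 0"
proof -
  have "dirichlet_form \<delta> (discretization \<Omega> \<delta>) f g = dirichlet_form \<delta> (discretization \<Omega> \<delta>) g f"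
    using assms dirichlet_eigenspace_supported by (intro dirichlet_form_sym) blast+
  hence "\<mu> * (\<Sum>x\<in>discretization \<Omega> \<delta>. f x * g x) = \<nu> * (\<Sum>x\<in>discretization \<Omega> \<delta>. f x * g x)"
    unfolding dirichlet_form_eigenfunction[OF assms(2)] dirichlet_form_eigenfunction[OF assms(3)]
    by (simp add: mult.commute)
  thus ?thesis using assms(4) by simp
qed

lemma sum_squares_supported_pos:
  fixes f :: "'a \<Rightarrow> real"
  assumes "finite S" "\<And>x. x \<notin> S \<Longrightarrow> f x = 0" "f y \<noteq> 0"
  shows "0 < (\<Sum>x\<in>S. f x * f x)"
proof -
  have "y \<in> S" using assms by blast
  moreover have "0 < f y * f y" using assms(3) not_real_square_gt_zero by blast
  ultimately show ?thesis
    using assms(1) by (intro sum_pos2[of S y]) auto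
qed

lemma sum_fun_apply: "(\<Sum>i\<in>I. F i) x = (\<Sum>i\<in>I. F i x :: 'b::comm_monoid_add)"
  by (induction I rule: infinite_finite_induct) auto

lemma finite_independent_supported:
  fixes B :: "('a \<Rightarrow> real) set"
  assumes "finite S" "\<And>f x. f \<in> B \<Longrightarrow> x \<notin> S \<Longrightarrow> f x = 0" "fun_space.independent B"
  shows "finite B"
proof -
  define e where "e = (\<lambda>x y :: 'a. if y = x then 1 else 0 :: real)"
  have "f \<in> fun_space.span (e ` S)" if f: "f \<in> B" for f
  proof -
    have "f y = (\<Sum>x\<in>S. f x * e x y)" for y
    proof -
      have "(\<Sum>x\<in>S. f x * e x y) = (\<Sum>x\<in>S. if x = y then f x else 0)"
        by (intro sum.cong) (auto simp: e_def)
      thus ?thesis using assms(1) assms(2)[OF f, of y] by simp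
    qed
    hence "f = (\<Sum>x\<in>S. (\<lambda>y. f x * e x y))"
      unfolding fun_eq_iff sum_fun_apply by blast
    moreover have "(\<Sum>x\<in>S. (\<lambda>y. f x * e x y)) \<in> fun_space.span (e ` S)"
      by (intro fun_space.span_sum fun_space.span_scale fun_space.span_base) auto
    ultimately show ?thesis by simp
  qed
  hence "B \<subseteq> fun_space.span (e ` S)" by (rule subsetI)
  moreover have "finite (e ` S)" using assms(1) by (rule finite_imageI)
  ultimately show ?thesis
    using fun_space.independent_span_bound[OF _ assms(3)] by blast
qed

text \<open>
  Choosing one eigenfunction per eigenvalue gives an orthogonal, hence independent, family in a space
  spanned by finitely many point masses.
\<close>

lemma finite_dirichlet_spectrum:
  assumes "finite (discretization \<Omega> \<delta>)"
  shows "finite (dirichlet_spectrum \<Omega> \<delta>)"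
proof -
  let ?S = "discretization \<Omega> \<delta>"
  have "\<forall>\<mu>\<in>dirichlet_spectrum \<Omega> \<delta>. \<exists>f. f \<in> dirichlet_eigenspace \<Omega> \<delta> \<mu> \<and> (\<exists>x. f x \<noteq> 0)"
    by (auto simp: dirichlet_spectrum_def)
  from bchoice[OF this] obtain e
    where e: "\<And>\<mu>. \<mu> \<in> dirichlet_spectrum \<Omega> \<delta> \<Longrightarrow> e \<mu> \<in> dirichlet_eigenspace \<Omega> \<delta> \<mu>"
      and nz: "\<And>\<mu>. \<mu> \<in> dirichlet_spectrum \<Omega> \<delta> \<Longrightarrow> \<exists>x. e \<mu> x \<noteq> 0"
    by blast
  have pos: "0 < (\<Sum>x\<in>?S. e \<mu> x * e \<mu> x)" if "\<mu> \<in> dirichlet_spectrum \<Omega> \<delta>" for \<mu>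
    using nz[OF that] e[OF that] assms dirichlet_eigenspace_supported
    by (metis sum_squares_supported_pos)
  have orth: "(\<Sum>x\<in>?S. e \<mu> x * e \<nu> x) = 0"
    if "\<mu> \<in> dirichlet_spectrum \<Omega> \<delta>" "\<nu> \<in> dirichlet_spectrum \<Omega> \<delta>" "\<mu> \<noteq> \<nu>" for \<mu> \<nu>
    using dirichlet_eigenspace_orthogonal[OF assms e[OF that(1)] e[OF that(2)] that(3)] .
  have inj: "inj_on e (dirichlet_spectrum \<Omega> \<delta>)"
    using pos orth by (intro inj_onI) (metis less_irrefl)
  have "fun_space.independent (e ` dirichlet_spectrum \<Omega> \<delta>)"
    unfolding fun_space.dependent_explicit
  proof safe
    fix T c v
    assume T: "finite T" "T \<subseteq> e ` dirichlet_spectrum \<Omega> \<delta>"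
      and sum0: "(\<Sum>v\<in>T. (\<lambda>x. c v * v x)) = 0" and v: "v \<in> T" "c v \<noteq> 0"
    have "0 = (\<Sum>x\<in>?S. (\<Sum>w\<in>T. (\<lambda>x. c w * w x)) x * v x)"
      by (simp add: sum0)
    also have "\<dots> = (\<Sum>x\<in>?S. \<Sum>w\<in>T. c w * (w x * v x))"
      by (simp add: sum_fun_apply sum_distrib_right mult.assoc)
    also have "\<dots> = (\<Sum>w\<in>T. c w * (\<Sum>x\<in>?S. w x * v x))"
      by (subst sum.swap) (simp add: sum_distrib_left)
    also have "\<dots> = (\<Sum>w\<in>T. if w = v then c v * (\<Sum>x\<in>?S. v x * v x) else 0)"
    proof (intro sum.cong refl)
      fix w assume "w \<in> T"
      then obtain \<mu> \<nu> where "\<mu> \<in> dirichlet_spectrum \<Omega> \<delta>" "w = e \<mu>" "\<nu> \<in> dirichlet_spectrum \<Omega> \<delta>" "v = e \<nu>"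
        using T v by blast
      thus "c w * (\<Sum>x\<in>?S. w x * v x) = (if w = v then c v * (\<Sum>x\<in>?S. v x * v x) else 0)"
        using orth by auto
    qed
    also have "\<dots> = c v * (\<Sum>x\<in>?S. v x * v x)"
      using T(1) v(1) by simp
    finally have "(\<Sum>x\<in>?S. v x * v x) = 0" using v(2) by simp
    moreover obtain \<nu> where "\<nu> \<in> dirichlet_spectrum \<Omega> \<delta>" "v = e \<nu>"
      using T(2) v(1) by blast
    ultimately show False using pos[of \<nu>] by simp
  qed
  hence "finite (e ` dirichlet_spectrum \<Omega> \<delta>)"
    using assms e dirichlet_eigenspace_supported
    by (intro finite_independent_supported[of ?S]) blast+
  thus ?thesis using inj by (rule finite_imageD)
qed

text \<open>
  Dimension is the cardinality of a basis, which would be 0 for an infinite one; so finiteness has to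
  be established for each eigenvalue to occur in the list at all.
\<close>

lemma dim_dirichlet_eigenspace_pos:
  assumes "finite (discretization \<Omega> \<delta>)" "\<mu> \<in> dirichlet_spectrum \<Omega> \<delta>"
  shows "0 < fun_space.dim (dirichlet_eigenspace \<Omega> \<delta> \<mu>)"
proof (rule ccontr)
  let ?V = "dirichlet_eigenspace \<Omega> \<delta> \<mu>"
  assume "\<not> 0 < fun_space.dim ?V"
  then obtain B where B: "B \<subseteq> ?V" "fun_space.independent B" "?V \<subseteq> fun_space.span B" "card B = 0"
    using fun_space.basis_exists[of ?V] by auto
  have "finite B"
    using B(1) dirichlet_eigenspace_supported
    by (intro finite_independent_supported[OF assms(1) _ B(2)]) blast
  with B have "?V \<subseteq> {0}" by simp
  thus False using assms(2) by (auto simp: dirichlet_spectrum_def)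
qed

lemma dirichlet_eigenvalue_1:
  assumes "finite (discretization \<Omega> \<delta>)" "dirichlet_spectrum \<Omega> \<delta> \<noteq> {}"
  shows "dirichlet_eigenvalue \<Omega> \<delta> 1 = Min (dirichlet_spectrum \<Omega> \<delta>)"
proof -
  let ?\<mu> = "Min (dirichlet_spectrum \<Omega> \<delta>)"
  note fin = finite_dirichlet_spectrum[OF assms(1)]
  obtain k where k: "fun_space.dim (dirichlet_eigenspace \<Omega> \<delta> ?\<mu>) = Suc k"
    using dim_dirichlet_eigenspace_pos[OF assms(1) Min_in[OF fin assms(2)]] gr0_implies_Suc by blast
  show ?thesis
    unfolding dirichlet_eigenvalue_def dirichlet_eigenvalue_list_def
      sorted_list_of_set_nonempty[OF fin assms(2)]
    by (simp add: k)
qed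

lemma dirichlet_eigenvalue_1_rayleigh:
  assumes "finite (discretization \<Omega> \<delta>)" "discretization \<Omega> \<delta> \<noteq> {}"
  shows "0 \<le> dirichlet_eigenvalue \<Omega> \<delta> 1"
    and "(\<And>x. x \<notin> discretization \<Omega> \<delta> \<Longrightarrow> g x = 0) \<Longrightarrow>
      dirichlet_eigenvalue \<Omega> \<delta> 1 * (\<Sum>x\<in>discretization \<Omega> \<delta>. (g x)\<^sup>2)
        \<le> dirichlet_form \<delta> (discretization \<Omega> \<delta>) g g"
proof -
  let ?S = "discretization \<Omega> \<delta>"
  obtain f \<rho> where f: "\<forall>x. x \<notin> ?S \<longrightarrow> f x = 0" "(\<Sum>x\<in>?S. (f x)\<^sup>2) = 1"
      "\<forall>x\<in>?S. - discrete_laplacian \<delta> f x = \<rho> * f x"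
    and ray: "\<forall>g. (\<forall>x. x \<notin> ?S \<longrightarrow> g x = 0) \<longrightarrow>
      \<rho> * (\<Sum>x\<in>?S. (g x)\<^sup>2) \<le> dirichlet_form \<delta> ?S g g"
    using rayleigh_minimizer[OF assms, of \<delta>] by (elim exE conjE) (rule that)
  have "\<exists>x. f x \<noteq> 0"
  proof (rule ccontr)
    assume "\<nexists>x. f x \<noteq> 0"
    thus False using f(2) by simp
  qed
  hence \<rho>: "\<rho> \<in> dirichlet_spectrum \<Omega> \<delta>"
    using f by (auto simp: dirichlet_spectrum_def dirichlet_eigenspace_def)
  hence eq: "dirichlet_eigenvalue \<Omega> \<delta> 1 = Min (dirichlet_spectrum \<Omega> \<delta>)"
    using dirichlet_eigenvalue_1[OF assms(1)] by blast
  have "0 \<le> \<mu>" if \<mu>: "\<mu> \<in> dirichlet_spectrum \<Omega> \<delta>" for \<mu>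
  proof -
    obtain h y where h: "h \<in> dirichlet_eigenspace \<Omega> \<delta> \<mu>" "h y \<noteq> 0"
      using \<mu> unfolding dirichlet_spectrum_def by blast
    have "0 \<le> \<mu> * (\<Sum>x\<in>?S. h x * h x)"
      using dirichlet_form_nonneg[OF assms(1), of h \<delta>] dirichlet_eigenspace_supported[OF h(1)]
      by (simp add: dirichlet_form_eigenfunction[OF h(1)])
    moreover have "0 < (\<Sum>x\<in>?S. h x * h x)"
      using sum_squares_supported_pos[OF assms(1), of h y] dirichlet_eigenspace_supported[OF h(1)] h(2)
      by blast
    ultimately show ?thesis by (simp add: zero_le_mult_iff)
  qed
  thus "0 \<le> dirichlet_eigenvalue \<Omega> \<delta> 1"
    unfolding eq using Min_in[OF finite_dirichlet_spectrum[OF assms(1)]] \<rho> by blast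
  assume g: "\<And>x. x \<notin> ?S \<Longrightarrow> g x = 0"
  have "dirichlet_eigenvalue \<Omega> \<delta> 1 \<le> \<rho>"
    unfolding eq using finite_dirichlet_spectrum[OF assms(1)] \<rho> by (rule Min_le)
  hence "dirichlet_eigenvalue \<Omega> \<delta> 1 * (\<Sum>x\<in>?S. (g x)\<^sup>2) \<le> \<rho> * (\<Sum>x\<in>?S. (g x)\<^sup>2)"
    by (intro mult_right_mono sum_nonneg) auto
  also have "\<dots> \<le> dirichlet_form \<delta> ?S g g" using ray g by simp
  finally show "dirichlet_eigenvalue \<Omega> \<delta> 1 * (\<Sum>x\<in>?S. (g x)\<^sup>2) \<le> dirichlet_form \<delta> ?S g g" .
qed

section \<open>Growth of the norm on horizontal levels\<close>

text \<open>
  The sequence $h_j = \cosh(j\alpha)$ solves the recursion with equality. The discrete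
  Wronskian $G_{j+1} h_j - G_j h_{j+1}$ is nonnegative at $j = 0$ and nondecreasing, so $G_j / h_j$ is
  nondecreasing.
\<close>

lemma cosh_comparison:
  fixes G :: "nat \<Rightarrow> real"
  assumes first: "cosh \<alpha> * G 0 \<le> G 1"
    and step: "\<And>j. Suc j < m \<Longrightarrow> 2 * cosh \<alpha> * G (Suc j) \<le> G (Suc (Suc j)) + G j"
  shows "cosh (real m * \<alpha>) * G 0 \<le> G m"
proof -
  define h where "h = (\<lambda>j. cosh (real j * \<alpha>))"
  have h_pos: "0 < h j" for j by (simp add: h_def)
  have h_rec: "h (Suc (Suc j)) + h j = 2 * cosh \<alpha> * h (Suc j)" for j
    using cosh_add[of "real (Suc j) * \<alpha>" \<alpha>] cosh_diff[of "real (Suc j) * \<alpha>" \<alpha>]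
    by (simp add: h_def algebra_simps)
  have wronskian: "G j * h (Suc j) \<le> G (Suc j) * h j" if "j < m" for j
    using that
  proof (induction j)
    case 0
    thus ?case using first by (simp add: h_def mult.commute)
  next
    case (Suc j)
    have "G (Suc j) * (h (Suc (Suc j)) + h j) = h (Suc j) * (2 * cosh \<alpha> * G (Suc j))"
      by (simp add: h_rec)
    also have "\<dots> \<le> h (Suc j) * (G (Suc (Suc j)) + G j)"
      using step[of j] Suc.prems h_pos[of "Suc j"] by (intro mult_left_mono) auto
    finally show ?case using Suc by (simp add: algebra_simps)
  qed
  have "h j * G 0 \<le> G j" if "j \<le> m" for j
    using that
  proof (induction j)
    case 0
    show ?case by (simp add: h_def)
  next
    case (Suc j)
    have "h (Suc j) * (h j * G 0) \<le> h (Suc j) * G j"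
      using Suc h_pos[of "Suc j"] by (intro mult_left_mono) auto
    also have "\<dots> \<le> G (Suc j) * h j"
      using wronskian[of j] Suc.prems by (simp add: mult.commute)
    finally have "h j * (h (Suc j) * G 0) \<le> h j * G (Suc j)"
      by (simp add: algebra_simps)
    thus ?case using h_pos[of j] by simp
  qed
  thus ?thesis by (simp add: h_def)
qed

lemma discrete_laplacian_prod:
  fixes u :: "'a::euclidean_space \<times> real \<Rightarrow> real"
  shows "discrete_laplacian \<delta> u (x, t) = discrete_laplacian \<delta> (\<lambda>y. u (y, t)) x
    + (u (x, t + \<delta>) + u (x, t - \<delta>) - 2 * u (x, t)) / \<delta>\<^sup>2"
proof -
  have "sum h (Basis :: ('a \<times> real) set) = (\<Sum>b\<in>Basis. h (b, 0)) + h (0, 1)" for h :: "'a \<times> real \<Rightarrow> real"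
  proof -
    have disj: "((\<lambda>b::'a. (b, 0::real)) ` Basis) \<inter> ((\<lambda>b::real. (0::'a, b)) ` Basis) = {}"
      by auto
    show ?thesis
      unfolding Basis_prod_def
      by (subst sum.union_disjoint[OF _ _ disj]) (auto simp: sum.reindex inj_on_def)
  qed
  thus ?thesis
    unfolding discrete_laplacian_def
    by (simp add: add_divide_distrib[symmetric] algebra_simps)
qed

text \<open>
  The energy inequality relating three consecutive levels. The function \<open>w\<close> in the proof is $u^+$ at
  height \<open>t\<close>, cut off to \<open>S\<close>; the sign condition on neighbours outside \<open>S\<close> ensures that it still
  dominates \<open>u\<close> at all points of that level entering the Laplacian.
\<close>

lemma level_norm_step:
  fixes u :: "'a::euclidean_space \<times> real \<Rightarrow> real"
  assumes S: "finite S" and \<delta>: "0 < \<delta>"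
    and ray: "\<And>g. (\<And>x. x \<notin> S \<Longrightarrow> g x = 0) \<Longrightarrow> \<mu> * (\<Sum>x\<in>S. (g x)\<^sup>2) \<le> dirichlet_form \<delta> S g g"
    and sub: "\<And>x. x \<in> S \<Longrightarrow> 0 \<le> discrete_laplacian \<delta> u (x, t)"
    and bdry: "\<And>x y. x \<in> S \<Longrightarrow> y \<notin> S \<Longrightarrow> neighbours \<delta> x y \<Longrightarrow> u (y, t) \<le> 0"
  shows "(2 + \<delta>\<^sup>2 * \<mu>) * L2_set (\<lambda>x. max 0 (u (x, t))) S
    \<le> L2_set (\<lambda>x. max 0 (u (x, t + \<delta>))) S + L2_set (\<lambda>x. max 0 (u (x, t - \<delta>))) S"
proof -
  define P where "P = (\<lambda>s x. max 0 (u (x, s)))"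
  define w where "w = (\<lambda>x. if x \<in> S then P t x else 0)"
  define F where "F = (\<lambda>s. L2_set (P s) S)"
  have pointwise: "2 * (P t x)\<^sup>2 - \<delta>\<^sup>2 * (discrete_laplacian \<delta> w x * w x)
      \<le> P (t + \<delta>) x * P t x + P (t - \<delta>) x * P t x" if x: "x \<in> S" for x
  proof (cases "0 < u (x, t)")
    case False
    thus ?thesis using x by (simp add: P_def w_def)
  next
    case True
    have w_x: "w x = u (x, t)" "P t x = u (x, t)" using True x by (auto simp: w_def P_def)
    have "u (y, t) \<le> w y" if "neighbours \<delta> x y" for y
      using bdry[OF x _ that] by (auto simp: w_def P_def)
    hence "discrete_laplacian \<delta> (\<lambda>y. u (y, t)) x \<le> discrete_laplacian \<delta> w x"
      unfolding discrete_laplacian_def w_x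
      by (intro divide_right_mono diff_right_mono sum_mono add_mono)
         (auto simp: neighbours_def)
    moreover have "(u (x, t + \<delta>) + u (x, t - \<delta>) - 2 * u (x, t)) / \<delta>\<^sup>2
        \<le> (P (t + \<delta>) x + P (t - \<delta>) x - 2 * w x) / \<delta>\<^sup>2"
      unfolding w_x by (intro divide_right_mono) (auto simp: P_def)
    ultimately have "0 \<le> discrete_laplacian \<delta> w x + (P (t + \<delta>) x + P (t - \<delta>) x - 2 * w x) / \<delta>\<^sup>2"
      using sub[OF x] unfolding discrete_laplacian_prod by linarith
    hence "0 \<le> \<delta>\<^sup>2 * (discrete_laplacian \<delta> w x + (P (t + \<delta>) x + P (t - \<delta>) x - 2 * w x) / \<delta>\<^sup>2)"
      by simp
    also have "\<dots> = \<delta>\<^sup>2 * discrete_laplacian \<delta> w x + (P (t + \<delta>) x + P (t - \<delta>) x - 2 * w x)"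
      using \<delta> by (simp add: distrib_left)
    finally have "0 \<le> (\<delta>\<^sup>2 * discrete_laplacian \<delta> w x + (P (t + \<delta>) x + P (t - \<delta>) x - 2 * w x)) * w x"
      using True w_x by simp
    thus ?thesis using w_x by (simp add: algebra_simps power2_eq_square)
  qed
  have cauchy: "(\<Sum>x\<in>S. P s x * P t x) \<le> F s * F t" for s
    using L2_set_mult_ineq[of "P s" "P t" S] by (simp add: P_def F_def)
  have F_sq: "(\<Sum>x\<in>S. (P t x)\<^sup>2) = (F t)\<^sup>2"
    by (simp add: F_def L2_set_def sum_nonneg)
  have "\<mu> * (F t)\<^sup>2 = \<mu> * (\<Sum>x\<in>S. (w x)\<^sup>2)"
    by (simp add: F_sq[symmetric] w_def cong: sum.cong)
  also have "\<dots> \<le> - (\<Sum>x\<in>S. discrete_laplacian \<delta> w x * w x)"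
    using ray[of w] by (simp add: w_def dirichlet_form_def sum_negf)
  finally have "\<delta>\<^sup>2 * (\<mu> * (F t)\<^sup>2) \<le> \<delta>\<^sup>2 * - (\<Sum>x\<in>S. discrete_laplacian \<delta> w x * w x)"
    by (intro mult_left_mono) auto
  moreover have "2 * (F t)\<^sup>2 - \<delta>\<^sup>2 * (\<Sum>x\<in>S. discrete_laplacian \<delta> w x * w x)
      \<le> F (t + \<delta>) * F t + F (t - \<delta>) * F t"
  proof -
    have "(\<Sum>x\<in>S. 2 * (P t x)\<^sup>2 - \<delta>\<^sup>2 * (discrete_laplacian \<delta> w x * w x))
        \<le> (\<Sum>x\<in>S. P (t + \<delta>) x * P t x + P (t - \<delta>) x * P t x)"
      using pointwise by (rule sum_mono)
    thus ?thesis
      using cauchy[of "t + \<delta>"] cauchy[of "t - \<delta>"]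
      by (simp add: sum_subtractf sum.distrib sum_distrib_left[symmetric] F_sq)
  qed
  ultimately have "((2 + \<delta>\<^sup>2 * \<mu>) * F t) * F t \<le> (F (t + \<delta>) + F (t - \<delta>)) * F t"
    by (simp add: algebra_simps power2_eq_square)
  moreover have "0 \<le> F s" for s by (simp add: F_def)
  ultimately have "(2 + \<delta>\<^sup>2 * \<mu>) * F t \<le> F (t + \<delta>) + F (t - \<delta>)"
    by (cases "F t = 0") (auto simp: mult_le_cancel_right less_le)
  thus ?thesis by (simp add: F_def P_def)
qed

section \<open>The lower bound for the maximum\<close>

lemma admissible_cosh_bound:
  fixes \<Omega> :: "'a::euclidean_space set"
  assumes \<Omega>: "bounded \<Omega>" and \<delta>: "0 < \<delta>" "1 / \<delta> \<in> \<nat>" and A: "0 < A"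
    and adm: "admissible \<Omega> \<delta> N A u"
  shows "A * cosh (decay_rate \<Omega> \<delta> 1 * real N)
    \<le> Max (u ` (discretization \<Omega> \<delta> \<times> closed_heights \<delta> N))"
proof -
  define S where "S = discretization \<Omega> \<delta>"
  define M where "M = Max (u ` (S \<times> closed_heights \<delta> N))"
  define \<mu> where "\<mu> = dirichlet_eigenvalue \<Omega> \<delta> 1"
  define \<alpha> where "\<alpha> = arcosh (1 + \<delta>\<^sup>2 * \<mu> / 2)"
  define F where "F = (\<lambda>t. L2_set (\<lambda>x. max 0 (u (x, t))) S)"
  \<comment> \<open>After symmetrizing in the height, the initial condition of the comparison,
    \<open>cosh \<alpha> * G 0 \<le> G 1\<close>, is the energy inequality at height 0.\<close>
  define G where "G = (\<lambda>j. F (\<delta> * real j) + F (- (\<delta> * real j)))"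
  have S: "finite S" "S \<noteq> {}"
    using finite_lattice_Int_bounded[OF \<Omega> \<delta>(1)] adm
    by (auto simp: S_def discretization_def admissible_def)
  have H: "finite (closed_heights \<delta> N)"
    unfolding closed_heights_def by (intro finite_lattice_Int_bounded \<delta>) auto
  \<comment> \<open>Since \<open>1 / \<delta>\<close> is an integer, the top height \<open>N\<close> is the lattice point with index \<open>m\<close>.\<close>
  obtain d where d: "1 / \<delta> = real d" using \<delta>(2) by (auto elim: Nats_cases)
  define m where "m = N * d"
  have m: "\<delta> * real m = real N"
    using \<delta>(1) d by (simp add: m_def field_simps)
  have le_M: "u (x, t) \<le> M" if "x \<in> S" "t \<in> closed_heights \<delta> N" for x t
    unfolding M_def using that S H by (intro Max_ge) auto
  have heights: "\<delta> * of_int k \<in> closed_heights \<delta> N" if "\<bar>k\<bar> \<le> int m" for k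
  proof -
    have "\<bar>\<delta> * of_int k\<bar> \<le> \<delta> * real m"
      using that \<delta>(1) by (simp add: abs_mult)
    thus ?thesis unfolding m closed_heights_def lattice_real by auto
  qed
  have open_heights: "\<delta> * of_int k \<in> open_heights \<delta> N" if "\<bar>k\<bar> < int m" for k
  proof -
    have "\<bar>\<delta> * of_int k\<bar> < \<delta> * real m"
      using that \<delta>(1) by (simp add: abs_mult)
    thus ?thesis unfolding m open_heights_def lattice_real by auto
  qed
  have \<mu>: "0 \<le> \<mu>"
    using dirichlet_eigenvalue_1_rayleigh(1)[of \<Omega> \<delta>] S by (simp add: \<mu>_def S_def)
  have cosh_\<alpha>: "2 * cosh \<alpha> = 2 + \<delta>\<^sup>2 * \<mu>"
    using \<mu> by (simp add: \<alpha>_def)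
  have step: "2 * cosh \<alpha> * F (\<delta> * of_int k) \<le> F (\<delta> * of_int (k + 1)) + F (\<delta> * of_int (k - 1))"
    if k: "\<bar>k\<bar> < int m" for k
  proof -
    let ?t = "\<delta> * real_of_int k"
    have "(2 + \<delta>\<^sup>2 * \<mu>) * F ?t \<le> F (?t + \<delta>) + F (?t - \<delta>)"
      unfolding F_def
    proof (rule level_norm_step[OF S(1) \<delta>(1)])
      show "\<mu> * (\<Sum>x\<in>S. (g x)\<^sup>2) \<le> dirichlet_form \<delta> S g g" if "\<And>x. x \<notin> S \<Longrightarrow> g x = 0" for g
        using dirichlet_eigenvalue_1_rayleigh(2)[of \<Omega> \<delta> g] S that by (simp add: \<mu>_def S_def)
      show "0 \<le> discrete_laplacian \<delta> u (x, ?t)" if "x \<in> S" for x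
        using adm that open_heights[OF k]
        by (auto simp: admissible_def discrete_subharmonic_on_def S_def)
      show "u (y, ?t) \<le> 0" if "x \<in> S" "y \<notin> S" "neighbours \<delta> x y" for x y
      proof -
        have "y \<in> lattice \<delta>"
          using lattice_neighbour that by (auto simp: S_def discretization_def)
        hence "y \<in> discrete_boundary \<Omega> \<delta>"
          using that neighbours_sym by (auto simp: discrete_boundary_def S_def)
        thus ?thesis using adm heights[of k] k by (auto simp: admissible_def)
      qed
    qed
    thus ?thesis unfolding cosh_\<alpha> by (simp add: algebra_simps)
  qed
  have "cosh (real m * \<alpha>) * G 0 \<le> G m"
  proof (cases "m = 0")
    case False
    show ?thesis
    proof (rule cosh_comparison)
      show "cosh \<alpha> * G 0 \<le> G 1" using step[of 0] False by (simp add: G_def)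
      show "2 * cosh \<alpha> * G (Suc j) \<le> G (Suc (Suc j)) + G j" if "Suc j < m" for j
      proof -
        have up: "\<delta> * of_int (int (Suc j)) = \<delta> * real (Suc j)"
            "\<delta> * of_int (int (Suc j) + 1) = \<delta> * real (Suc (Suc j))"
            "\<delta> * of_int (int (Suc j) - 1) = \<delta> * real j"
          by (simp_all add: algebra_simps)
        have down: "\<delta> * of_int (- int (Suc j)) = - (\<delta> * real (Suc j))"
            "\<delta> * of_int (- int (Suc j) + 1) = - (\<delta> * real j)"
            "\<delta> * of_int (- int (Suc j) - 1) = - (\<delta> * real (Suc (Suc j)))"
          by (simp_all add: algebra_simps)
        have "\<bar>int (Suc j)\<bar> < int m" "\<bar>- int (Suc j)\<bar> < int m"
          using that by simp_all
        from step[OF this(1), unfolded up] step[OF this(2), unfolded down]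
        show ?thesis unfolding G_def distrib_left by linarith
      qed
    qed
  qed simp
  moreover have "G 0 = 2 * A * sqrt (card S)"
    using adm A by (simp add: G_def F_def L2_set_def admissible_def S_def real_sqrt_mult)
  moreover have "G m \<le> 2 * M * sqrt (card S)"
  proof -
    have "\<exists>x\<in>S. 0 < u (x, 0)"
    proof (rule ccontr)
      assume "\<not> (\<exists>x\<in>S. 0 < u (x, 0))"
      hence "(\<Sum>x\<in>S. (max 0 (u (x, 0)))\<^sup>2) = 0"
        by (intro sum.neutral) (auto simp: max_def not_less intro: antisym)
      thus False using adm by (auto simp: admissible_def S_def)
    qed
    hence M: "0 < M" using le_M heights[of 0] by (force simp: less_le_trans)
    have "F t \<le> M * sqrt (card S)" if "t \<in> closed_heights \<delta> N" for t
    proof -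
      have "(\<Sum>x\<in>S. (max 0 (u (x, t)))\<^sup>2) \<le> (\<Sum>x\<in>S. M\<^sup>2)"
        using le_M that M by (intro sum_mono power_mono) auto
      hence "F t \<le> sqrt (card S * M\<^sup>2)"
        unfolding F_def L2_set_def by (intro real_sqrt_le_mono) simp
      thus ?thesis using M by (simp add: real_sqrt_mult mult.commute)
    qed
    from this[of "\<delta> * real m"] this[of "- (\<delta> * real m)"] show ?thesis
      using heights[of "int m"] heights[of "- int m"] by (simp add: G_def)
  qed
  ultimately have "cosh (real m * \<alpha>) * (2 * A * sqrt (card S)) \<le> 2 * M * sqrt (card S)"
    by simp
  hence "(2 * sqrt (card S)) * (A * cosh (real m * \<alpha>)) \<le> (2 * sqrt (card S)) * M"
    by (simp add: algebra_simps)
  moreover have "0 < 2 * sqrt (card S)" using S by (simp add: card_gt_0_iff)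
  ultimately have "A * cosh (real m * \<alpha>) \<le> M"
    by (simp only: mult_le_cancel_left_pos)
  moreover have "decay_rate \<Omega> \<delta> 1 * real N = real m * \<alpha>"
    using \<delta>(1) by (simp add: decay_rate_def \<alpha>_def \<mu>_def m[symmetric])
  ultimately show ?thesis by (simp add: M_def S_def)
qed

theorem theorem4:
  fixes \<Omega> :: "(real ^ 'n) set"
  assumes "open \<Omega>" "connected \<Omega>" "\<Omega> \<noteq> {}" "bounded \<Omega>" "lipschitz_boundary \<Omega>"
  shows
    "(\<forall>\<delta>\<^sub>0 \<delta> N A. \<forall>u :: (real ^ 'n) \<times> real \<Rightarrow> real.
        mesh_threshold \<Omega> \<delta>\<^sub>0 \<and> 0 < \<delta> \<and> \<delta> < \<delta>\<^sub>0 \<and> 1 / \<delta> \<in> \<nat> \<and> 0 < N \<and> 0 < A \<and> admissible \<Omega> \<delta> N A u \<longrightarrow>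
        A / 2 * inverse (\<Sum>k = 1..card (discretization \<Omega> \<delta>). exp (- decay_rate \<Omega> \<delta> k * real N))
          \<le> Max (u ` (discretization \<Omega> \<delta> \<times> closed_heights \<delta> N))) \<and>
     (\<exists>C>0. \<forall>\<delta>\<^sub>0 \<delta> N A. \<forall>u :: (real ^ 'n) \<times> real \<Rightarrow> real.
        mesh_threshold \<Omega> \<delta>\<^sub>0 \<and> 0 < \<delta> \<and> \<delta> < \<delta>\<^sub>0 \<and> 1 / \<delta> \<in> \<nat> \<and> 0 < N \<and> 0 < A \<and> admissible \<Omega> \<delta> N A u \<longrightarrow>
        C * A * exp (decay_rate \<Omega> \<delta> 1 * real N)
          \<le> Max (u ` (discretization \<Omega> \<delta> \<times> closed_heights \<delta> N)))"
proof -
  have main: "1 / 2 * A * exp (decay_rate \<Omega> \<delta> 1 * real N)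
      \<le> Max (u ` (discretization \<Omega> \<delta> \<times> closed_heights \<delta> N))"
    if "0 < \<delta>" "1 / \<delta> \<in> \<nat>" "0 < A" "admissible \<Omega> \<delta> N A u" for \<delta> N A u
  proof -
    have "exp a / 2 \<le> cosh a" for a :: real
      by (simp add: cosh_def)
    hence "A * (exp (decay_rate \<Omega> \<delta> 1 * real N) / 2) \<le> A * cosh (decay_rate \<Omega> \<delta> 1 * real N)"
      using that(3) by (intro mult_left_mono) auto
    thus ?thesis using admissible_cosh_bound[OF assms(4) that] by simp
  qed
  have sum_bound: "A / 2 * inverse (\<Sum>k = 1..card (discretization \<Omega> \<delta>). exp (- decay_rate \<Omega> \<delta> k * real N))
      \<le> 1 / 2 * A * exp (decay_rate \<Omega> \<delta> 1 * real N)"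
    if "0 < A" "admissible \<Omega> \<delta> N A u" for \<delta> A N and u :: "(real ^ 'n) \<times> real \<Rightarrow> real"
  proof -
    have "0 < card (discretization \<Omega> \<delta>)"
      using that by (auto simp: admissible_def intro: gr0I)
    hence "exp (- decay_rate \<Omega> \<delta> 1 * real N)
        \<le> (\<Sum>k = 1..card (discretization \<Omega> \<delta>). exp (- decay_rate \<Omega> \<delta> k * real N))"
      by (intro member_le_sum) auto
    hence "inverse (\<Sum>k = 1..card (discretization \<Omega> \<delta>). exp (- decay_rate \<Omega> \<delta> k * real N))
        \<le> inverse (exp (- decay_rate \<Omega> \<delta> 1 * real N))"
      by (intro le_imp_inverse_le) auto
    also have "\<dots> = exp (decay_rate \<Omega> \<delta> 1 * real N)"
      by (simp add: exp_minus)
    finally show ?thesis using that(1) by simp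
  qed
  show ?thesis
  proof (intro conjI exI[of _ "1 / 2"] allI impI)
    show "0 < (1 / 2 :: real)" by simp
  qed (use main sum_bound in \<open>blast intro: order_trans\<close>)+
qed

end
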